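(* Let $(X,A,m,\alpha)$ be a micro-macro system. Then $H(q)\le H(c\alpha_*q)$ for all $q\in\mathrm{cProb}(X)$, and $H(q)+S(q)\le H([\alpha]q)+S([\alpha]q)$ for all $q\in\mathrm{Prob}(A)$.
   Context: A micro-macro system $(X,A,m,\alpha)$ consists of finite sets $X$, $A$, a bijection $\alpha:X\to X$ and a surjection $m:X\to A$; identify $a\in A$ with $m^{-1}(a)$, $|a|=|m^{-1}(a)|$, $S(a)=\ln|a|$. For a probability $q$ on a finite set, $H(q)=-\sum q_x\ln q_x$ (Shannon entropy); for $q\in\mathrm{Prob}(A)$, $S(q)=\sum_a q_aS(a)$ (mean Boltzmann entropy). $[\alpha]q$ is given by $([\alpha]q)_b=\sum_a q_a\frac{|\{i\in a:\alpha(i)\in b\}|}{|a|}$. $(\alpha_*q)_i=q_{\alpha^{-1}i}$; the coarse-graining $c$ on $\mathrm{Prob}(X)$ is $(cq)_i=q(m^{-1}(m(i)))/|m(i)|$, and $\mathrm{cProb}(X)$ is its image (probabilities constant on each $m^{-1}(a)$). *)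

theory Defs
  imports Complex_Main
begin

locale micro_macro_system =
  fixes X :: "'x set" and A :: "'a set" and m :: "'x \<Rightarrow> 'a" and \<alpha> :: "'x \<Rightarrow> 'x"
  assumes finite_X: "finite X"
    and finite_A: "finite A"
    and surj_m: "m ` X = A"
    and bij_\<alpha>: "bij_betw \<alpha> X X"

definition fibre :: "'x set \<Rightarrow> ('x \<Rightarrow> 'a) \<Rightarrow> 'a \<Rightarrow> 'x set"
  where "fibre X m a = {i \<in> X. m i = a}"

text \<open>
  A probability on a finite set is represented by its unique extension by zero to the
  whole type; the operations below preserve this convention.
\<close>

definition Prob :: "'s set \<Rightarrow> ('s \<Rightarrow> real) set"
  where "Prob X = {q. (\<forall>x\<in>X. 0 \<le> q x) \<and> (\<forall>x. x \<notin> X \<longrightarrow> q x = 0) \<and> (\<Sum>x\<in>X. q x) = 1}"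

definition shannon_entropy :: "'s set \<Rightarrow> ('s \<Rightarrow> real) \<Rightarrow> real"
  where "shannon_entropy X q = - (\<Sum>x\<in>X. q x * ln (q x))"

definition boltzmann_entropy :: "'x set \<Rightarrow> ('x \<Rightarrow> 'a) \<Rightarrow> 'a \<Rightarrow> real"
  where "boltzmann_entropy X m a = ln (real (card (fibre X m a)))"

definition mean_boltzmann_entropy ::
    "'x set \<Rightarrow> 'a set \<Rightarrow> ('x \<Rightarrow> 'a) \<Rightarrow> ('a \<Rightarrow> real) \<Rightarrow> real"
  where "mean_boltzmann_entropy X A m q = (\<Sum>a\<in>A. q a * boltzmann_entropy X m a)"

definition macro_evolution ::
    "'x set \<Rightarrow> 'a set \<Rightarrow> ('x \<Rightarrow> 'a) \<Rightarrow> ('x \<Rightarrow> 'x) \<Rightarrow> ('a \<Rightarrow> real) \<Rightarrow> 'a \<Rightarrow> real"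
  where "macro_evolution X A m \<alpha> q b =
    (if b \<in> A then
       \<Sum>a\<in>A. q a * (real (card {i \<in> fibre X m a. \<alpha> i \<in> fibre X m b}) / real (card (fibre X m a)))
     else 0)"

definition pushforward :: "'x set \<Rightarrow> ('x \<Rightarrow> 'x) \<Rightarrow> ('x \<Rightarrow> real) \<Rightarrow> 'x \<Rightarrow> real"
  where "pushforward X \<alpha> q i = (if i \<in> X then q (inv_into X \<alpha> i) else 0)"

definition coarse_grain :: "'x set \<Rightarrow> ('x \<Rightarrow> 'a) \<Rightarrow> ('x \<Rightarrow> real) \<Rightarrow> 'x \<Rightarrow> real"
  where "coarse_grain X m q i =
    (if i \<in> X then (\<Sum>j\<in>fibre X m (m i). q j) / real (card (fibre X m (m i))) else 0)"

definition cProb :: "'x set \<Rightarrow> ('x \<Rightarrow> 'a) \<Rightarrow> ('x \<Rightarrow> real) set"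
  where "cProb X m = coarse_grain X m ` Prob X"

context micro_macro_system
begin

lemma finite_fibre [simp]: "finite (fibre X m a)"
  using finite_X by (simp add: fibre_def)

lemma card_fibre_pos: "i \<in> X \<Longrightarrow> 0 < card (fibre X m (m i))"
  by (subst card_gt_0_iff) (auto simp: fibre_def finite_X)

lemma sum_fibres: "(\<Sum>a\<in>A. \<Sum>i\<in>fibre X m a. f i) = (\<Sum>i\<in>X. f i)"
  using sum.group[OF finite_X finite_A, of m f] surj_m by (simp add: fibre_def)

lemma pushforward_Prob:
  assumes "q \<in> Prob X" shows "pushforward X \<alpha> q \<in> Prob X"
proof -
  have b: "bij_betw (inv_into X \<alpha>) X X"
    using bij_\<alpha> by (rule bij_betw_inv_into)
  have "(\<Sum>i\<in>X. q (inv_into X \<alpha> i)) = (\<Sum>i\<in>X. q i)"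
    using b by (rule sum.reindex_bij_betw)
  then show ?thesis
    using assms bij_betwE[OF b] by (auto simp: Prob_def pushforward_def)
qed

lemma coarse_grain_Prob:
  assumes "q \<in> Prob X" shows "coarse_grain X m q \<in> Prob X"
proof -
  have "(\<Sum>i\<in>fibre X m a. coarse_grain X m q i) = (\<Sum>i\<in>fibre X m a. q i)" if a: "a \<in> A" for a
  proof -
    obtain j where j: "j \<in> X" "a = m j" using a surj_m by blast
    have "(\<Sum>i\<in>fibre X m a. coarse_grain X m q i)
        = (\<Sum>i\<in>fibre X m a. (\<Sum>j\<in>fibre X m a. q j) / real (card (fibre X m a)))"
      by (rule sum.cong) (auto simp: coarse_grain_def fibre_def)
    then show ?thesis using card_fibre_pos[OF j(1)] j(2) by simp
  qed
  then have "(\<Sum>i\<in>X. coarse_grain X m q i) = (\<Sum>i\<in>X. q i)"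
    unfolding sum_fibres[symmetric] by (rule sum.cong[OF refl])
  then show ?thesis
    using assms by (auto simp: Prob_def coarse_grain_def fibre_def intro!: divide_nonneg_nonneg sum_nonneg)
qed

lemma cProb_eq:
  "cProb X m = {q \<in> Prob X. \<forall>i\<in>X. \<forall>j\<in>X. m i = m j \<longrightarrow> q i = q j}"
proof (intro equalityI subsetI)
  fix q assume "q \<in> cProb X m"
  then show "q \<in> {q \<in> Prob X. \<forall>i\<in>X. \<forall>j\<in>X. m i = m j \<longrightarrow> q i = q j}"
    by (auto simp: cProb_def coarse_grain_Prob) (simp add: coarse_grain_def)
next
  fix q assume q: "q \<in> {q \<in> Prob X. \<forall>i\<in>X. \<forall>j\<in>X. m i = m j \<longrightarrow> q i = q j}"
  have "coarse_grain X m q i = q i" for i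
  proof (cases "i \<in> X")
    case True
    have "(\<Sum>j\<in>fibre X m (m i). q j) = (\<Sum>j\<in>fibre X m (m i). q i)"
    proof (rule sum.cong[OF refl])
      fix j assume "j \<in> fibre X m (m i)"
      then have "j \<in> X" "m j = m i" by (simp_all add: fibre_def)
      then show "q j = q i" using q True by blast
    qed
    then show ?thesis using True card_fibre_pos[OF True] by (auto simp: coarse_grain_def)
  next
    case False
    then show ?thesis using q by (simp add: coarse_grain_def Prob_def)
  qed
  then have "coarse_grain X m q = q" by (rule ext)
  then show "q \<in> cProb X m" using q unfolding cProb_def by (metis (lifting) image_eqI mem_Collect_eq)
qed

lemma macro_evolution_Prob:
  assumes "q \<in> Prob A" shows "macro_evolution X A m \<alpha> q \<in> Prob A"
proof -
  have row: "(\<Sum>b\<in>A. real (card {i \<in> fibre X m a. \<alpha> i \<in> fibre X m b}) / real (card (fibre X m a))) = 1"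
    if a: "a \<in> A" for a
  proof -
    obtain j where j: "j \<in> X" "a = m j" using a surj_m by blast
    have eq: "{i \<in> fibre X m a. \<alpha> i \<in> fibre X m b} = {i \<in> fibre X m a. m (\<alpha> i) = b}" for b
      using bij_betwE[OF bij_\<alpha>] by (auto simp: fibre_def)
    have "(\<lambda>i. m (\<alpha> i)) ` fibre X m a \<subseteq> A"
      using bij_betwE[OF bij_\<alpha>] surj_m by (auto simp: fibre_def)
    from sum.group[OF finite_fibre finite_A this, of "\<lambda>_. 1 :: real"]
    have "(\<Sum>b\<in>A. real (card {i \<in> fibre X m a. \<alpha> i \<in> fibre X m b})) = real (card (fibre X m a))"
      by (simp add: eq)
    then show ?thesis
      using card_fibre_pos[OF j(1)] unfolding j(2) sum_divide_distrib[symmetric] by (metis divide_self_if less_irrefl of_nat_eq_0_iff)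
  qed
  have "(\<Sum>b\<in>A. macro_evolution X A m \<alpha> q b)
      = (\<Sum>a\<in>A. \<Sum>b\<in>A. q a * (real (card {i \<in> fibre X m a. \<alpha> i \<in> fibre X m b}) / real (card (fibre X m a))))"
    unfolding macro_evolution_def by (subst sum.swap) simp
  also have "\<dots> = (\<Sum>a\<in>A. q a)"
    unfolding sum_distrib_left[symmetric] by (rule sum.cong) (simp_all only: row mult_1_right)
  finally show ?thesis
    using assms by (auto simp: Prob_def macro_evolution_def intro!: sum_nonneg)
qed

end

end

theory Submission
  imports Defs
begin

text \<open>
  The pushforward along a bijection preserves Shannon entropy, and coarse-graining does not
  decrease it: \<open>c p\<close> is constant on fibres, so the cross entropy of \<open>p\<close> relative to \<open>c p\<close> equals
  \<open>H (c p)\<close>, and Gibbs' inequality applies. The macroscopic inequality is the microscopic one for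
  the probability that spreads each \<open>q a\<close> uniformly over the fibre of \<open>a\<close>: this lift turns \<open>H + S\<close>
  into \<open>H\<close> and the macroscopic evolution into pushforward followed by coarse-graining.
\<close>

text \<open>The tangent bound \<open>ln t \<le> t - 1\<close> at \<open>t = r / p\<close>,
  multiplied by \<open>p\<close>. The third hypothesis excludes \<open>r = 0 < p\<close>, where
  \<open>ln r\<close> is only a default value instead of minus infinity.\<close>

lemma mult_ln_le_mult_ln_add_diff:
  fixes p r :: real
  assumes "0 \<le> p" "0 \<le> r" "r = 0 \<Longrightarrow> p = 0"
  shows "p * ln r \<le> p * ln p + (r - p)"
proof (cases "p = 0")
  case True
  then show ?thesis using assms by simp
next
  case False
  then have "p > 0" "r > 0" using assms by (metis less_eq_real_def)+
  then have "ln r - ln p \<le> r / p - 1"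
    using ln_le_minus_one[of "r / p"] by (simp add: ln_div)
  then have "p * (ln r - ln p) \<le> p * (r / p - 1)"
    using \<open>p > 0\<close> by (intro mult_left_mono) auto
  then show ?thesis using \<open>p > 0\<close> by (simp add: algebra_simps)
qed

text \<open>Summing the pointwise bound, the corrections \<open>r x - p x\<close> cancel because
  both total masses are 1. The support condition keeps the cross entropy finite.\<close>

lemma Gibbs_inequality:
  assumes "p \<in> Prob S" "r \<in> Prob S" "\<And>x. x \<in> S \<Longrightarrow> r x = 0 \<Longrightarrow> p x = 0"
  shows "shannon_entropy S p \<le> - (\<Sum>x\<in>S. p x * ln (r x))"
proof -
  have "(\<Sum>x\<in>S. p x * ln (r x)) \<le> (\<Sum>x\<in>S. p x * ln (p x) + (r x - p x))"
    using assms by (intro sum_mono mult_ln_le_mult_ln_add_diff) (auto simp: Prob_def)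
  also have "\<dots> = (\<Sum>x\<in>S. p x * ln (p x))"
    using assms by (simp add: sum.distrib sum_subtractf Prob_def)
  finally show ?thesis by (simp add: shannon_entropy_def)
qed

definition uniform_lift :: "'x set \<Rightarrow> ('x \<Rightarrow> 'a) \<Rightarrow> ('a \<Rightarrow> real) \<Rightarrow> 'x \<Rightarrow> real"
  where "uniform_lift X m q i = (if i \<in> X then q (m i) / real (card (fibre X m (m i))) else 0)"

context micro_macro_system
begin

lemma card_fibre_pos': "a \<in> A \<Longrightarrow> 0 < card (fibre X m a)"
  using card_fibre_pos surj_m by blast

lemma shannon_entropy_pushforward:
  "shannon_entropy X (pushforward X \<alpha> q) = shannon_entropy X q"
  using sum.reindex_bij_betw[OF bij_betw_inv_into[OF bij_\<alpha>], of "\<lambda>x. q x * ln (q x)"]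
  by (simp add: shannon_entropy_def pushforward_def)

text \<open>Averaging keeps the mass of every fibre, and a function constant on fibres sees only
  these masses.\<close>

lemma sum_mult_coarse_grain:
  assumes "\<And>i j. i \<in> X \<Longrightarrow> j \<in> X \<Longrightarrow> m i = m j \<Longrightarrow> f i = f j"
  shows "(\<Sum>i\<in>X. coarse_grain X m p i * f i) = (\<Sum>i\<in>X. p i * f i)"
proof -
  have "(\<Sum>i\<in>fibre X m a. coarse_grain X m p i * f i) = (\<Sum>i\<in>fibre X m a. p i * f i)"
    if a: "a \<in> A" for a
  proof -
    obtain j where j: "j \<in> X" "a = m j" using a surj_m by blast
    have f: "f i = f j" if "i \<in> fibre X m a" for i
      using that j by (intro assms) (auto simp: fibre_def)
    have "(\<Sum>i\<in>fibre X m a. coarse_grain X m p i * f i)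
        = (\<Sum>i\<in>fibre X m a. (\<Sum>k\<in>fibre X m a. p k) / real (card (fibre X m a)) * f j)"
      by (intro sum.cong[OF refl] arg_cong2[where f = times] f)
        (auto simp: coarse_grain_def fibre_def)
    also have "\<dots> = (\<Sum>i\<in>fibre X m a. p i) * f j"
      using card_fibre_pos'[OF a] by simp
    also have "\<dots> = (\<Sum>i\<in>fibre X m a. p i * f i)"
      unfolding sum_distrib_right
      by (intro sum.cong[OF refl] arg_cong2[where f = times] f[symmetric] refl)
    finally show ?thesis .
  qed
  then show ?thesis
    unfolding sum_fibres[symmetric] by (rule sum.cong[OF refl])
qed

text \<open>A vanishing average of nonnegative values forces each value to vanish; this supplies the
  support condition for Gibbs' inequality.\<close>

lemma coarse_grain_eq_0D:
  assumes "p \<in> Prob X" "i \<in> X" "coarse_grain X m p i = 0"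
  shows "p i = 0"
proof -
  have "(\<Sum>j\<in>fibre X m (m i). p j) = 0"
    using assms card_fibre_pos[OF \<open>i \<in> X\<close>] by (auto simp: coarse_grain_def)
  moreover have "\<forall>j\<in>fibre X m (m i). 0 \<le> p j"
    using assms by (auto simp: fibre_def Prob_def)
  ultimately have "\<forall>j\<in>fibre X m (m i). p j = 0"
    by (simp add: sum_nonneg_eq_0_iff)
  then show ?thesis using \<open>i \<in> X\<close> by (simp add: fibre_def)
qed

lemma shannon_entropy_le_coarse_grain:
  assumes "p \<in> Prob X"
  shows "shannon_entropy X p \<le> shannon_entropy X (coarse_grain X m p)"
proof -
  \<comment> \<open>The logarithm of \<open>coarse_grain X m p\<close> is itself constant on fibres,
    hence an admissible \<open>f\<close>.\<close>
  have "(\<Sum>i\<in>X. coarse_grain X m p i * ln (coarse_grain X m p i))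
      = (\<Sum>i\<in>X. p i * ln (coarse_grain X m p i))"
    by (rule sum_mult_coarse_grain) (simp add: coarse_grain_def)
  then show ?thesis
    using Gibbs_inequality[OF assms coarse_grain_Prob[OF assms]] coarse_grain_eq_0D[OF assms]
    by (simp add: shannon_entropy_def)
qed

lemma shannon_entropy_le_evolution:
  assumes "p \<in> Prob X"
  shows "shannon_entropy X p \<le> shannon_entropy X (coarse_grain X m (pushforward X \<alpha> p))"
  using shannon_entropy_le_coarse_grain[OF pushforward_Prob[OF assms]]
  by (simp add: shannon_entropy_pushforward)

text \<open>A general \<open>f\<close> covers both uses: the identity for total mass and
  \<open>x * ln x\<close> for entropy.\<close>

lemma sum_uniform_lift_fibre:
  assumes "a \<in> A"
  shows "(\<Sum>i\<in>fibre X m a. f (uniform_lift X m q i))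
    = real (card (fibre X m a)) * f (q a / real (card (fibre X m a)))"
proof -
  have "uniform_lift X m q i = q a / real (card (fibre X m a))" if "i \<in> fibre X m a" for i
    using that by (auto simp: uniform_lift_def fibre_def)
  then show ?thesis by simp
qed

lemma uniform_lift_Prob:
  assumes "q \<in> Prob A"
  shows "uniform_lift X m q \<in> Prob X"
proof -
  have "(\<Sum>i\<in>X. uniform_lift X m q i) = (\<Sum>a\<in>A. q a)"
    unfolding sum_fibres[symmetric]
    by (rule sum.cong[OF refl])
      (use card_fibre_pos' in \<open>fastforce simp: sum_uniform_lift_fibre[of _ "\<lambda>x. x"]\<close>)
  moreover have "0 \<le> q (m i)" if "i \<in> X" for i
    using that assms surj_m by (auto simp: Prob_def)
  ultimately show ?thesis using assms by (auto simp: Prob_def uniform_lift_def)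
qed

lemma shannon_entropy_uniform_lift:
  assumes "q \<in> Prob A"
  shows "shannon_entropy X (uniform_lift X m q)
    = shannon_entropy A q + mean_boltzmann_entropy X A m q"
proof -
  have "(\<Sum>i\<in>fibre X m a. uniform_lift X m q i * ln (uniform_lift X m q i))
      = q a * ln (q a) - q a * boltzmann_entropy X m a" if a: "a \<in> A" for a
  proof -
    have "(\<Sum>i\<in>fibre X m a. uniform_lift X m q i * ln (uniform_lift X m q i))
        = q a * ln (q a / real (card (fibre X m a)))"
      using card_fibre_pos'[OF a] sum_uniform_lift_fibre[OF a, of "\<lambda>x. x * ln x"] by simp
    \<comment> \<open>Splitting the logarithm of the quotient requires \<open>0 < q a\<close>; for
      \<open>q a = 0\<close> the factor \<open>q a\<close> makes both sides vanish.\<close>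
    moreover have "q a = 0 \<or> 0 < q a"
      using a assms by (fastforce simp: Prob_def)
    ultimately show ?thesis
      using card_fibre_pos'[OF a] by (auto simp: boltzmann_entropy_def ln_div algebra_simps)
  qed
  then have "(\<Sum>i\<in>X. uniform_lift X m q i * ln (uniform_lift X m q i))
      = (\<Sum>a\<in>A. q a * ln (q a) - q a * boltzmann_entropy X m a)"
    unfolding sum_fibres[symmetric] by (rule sum.cong[OF refl])
  then show ?thesis
    by (simp add: shannon_entropy_def mean_boltzmann_entropy_def sum_subtractf)
qed

text \<open>Reindexing along \<alpha>: the new mass of a fibre is the old mass of its
  preimage.\<close>

lemma sum_pushforward_fibre:
  "(\<Sum>j\<in>fibre X m b. pushforward X \<alpha> p j) = (\<Sum>i | i \<in> X \<and> \<alpha> i \<in> fibre X m b. p i)"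
proof (rule sum.reindex_bij_witness[of _ \<alpha> "inv_into X \<alpha>"])
  fix j assume "j \<in> fibre X m b"
  then have j: "j \<in> X" "j \<in> \<alpha> ` X" "j \<in> fibre X m b"
    using bij_\<alpha> by (auto simp: fibre_def bij_betw_def)
  then show "\<alpha> (inv_into X \<alpha> j) = j" by (simp add: f_inv_into_f)
  then show "inv_into X \<alpha> j \<in> {i \<in> X. \<alpha> i \<in> fibre X m b}"
    using j by (simp add: inv_into_into)
  show "p (inv_into X \<alpha> j) = pushforward X \<alpha> p j"
    using j by (simp add: pushforward_def)
qed (use bij_\<alpha> in \<open>auto simp: bij_betw_def\<close>)

lemma coarse_grain_pushforward_uniform_lift:
  "coarse_grain X m (pushforward X \<alpha> (uniform_lift X m q))
    = uniform_lift X m (macro_evolution X A m \<alpha> q)"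
proof -
  have "(\<Sum>j\<in>fibre X m b. pushforward X \<alpha> (uniform_lift X m q) j) = macro_evolution X A m \<alpha> q b"
    if b: "b \<in> A" for b
  proof -
    let ?T = "\<lambda>a. {i \<in> fibre X m a. \<alpha> i \<in> fibre X m b}"
    \<comment> \<open>The condition on \<open>\<alpha> i\<close> becomes an indicator, so that the
      sum over \<open>X\<close> splits by source fibre. Each point of \<open>?T a\<close> then
      weighs \<open>q a\<close> divided by the size of its fibre, which produces the transition
      probability from \<open>a\<close> to \<open>b\<close>.\<close>
    have "(\<Sum>j\<in>fibre X m b. pushforward X \<alpha> (uniform_lift X m q) j)
        = (\<Sum>i\<in>X. if \<alpha> i \<in> fibre X m b then uniform_lift X m q i else 0)"
      by (simp add: sum_pushforward_fibre sum.inter_filter finite_X)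
    also have "\<dots> = (\<Sum>a\<in>A. \<Sum>i\<in>?T a. uniform_lift X m q i)"
      by (simp add: sum_fibres[symmetric] sum.inter_filter)
    also have "\<dots> = (\<Sum>a\<in>A. \<Sum>i\<in>?T a. q a / real (card (fibre X m a)))"
      by (intro sum.cong[OF refl]) (auto simp: uniform_lift_def fibre_def)
    also have "\<dots> = macro_evolution X A m \<alpha> q b"
      using b by (simp add: macro_evolution_def mult.commute)
    finally show ?thesis .
  qed
  \<comment> \<open>Both sides divide a fibre mass by the fibre size, so equality of the masses
    suffices.\<close>
  then show ?thesis
    using surj_m by (auto simp: fun_eq_iff coarse_grain_def uniform_lift_def)
qed

end

theorem theorem17:
  fixes X :: "'x set" and A :: "'a set" and m :: "'x \<Rightarrow> 'a" and \<alpha> :: "'x \<Rightarrow> 'x"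
  assumes "micro_macro_system X A m \<alpha>"
  shows "(\<forall>q \<in> cProb X m.
            shannon_entropy X q \<le> shannon_entropy X (coarse_grain X m (pushforward X \<alpha> q))) \<and>
         (\<forall>q \<in> Prob A.
            shannon_entropy A q + mean_boltzmann_entropy X A m q
              \<le> shannon_entropy A (macro_evolution X A m \<alpha> q)
                + mean_boltzmann_entropy X A m (macro_evolution X A m \<alpha> q))"
proof -
  interpret micro_macro_system X A m \<alpha> by (rule assms)
  show ?thesis
  proof (intro conjI ballI)
    fix q assume "q \<in> cProb X m"
    then show "shannon_entropy X q \<le> shannon_entropy X (coarse_grain X m (pushforward X \<alpha> q))"
      by (intro shannon_entropy_le_evolution) (simp add: cProb_eq)
  next
    fix q assume q: "q \<in> Prob A"
    show "shannon_entropy A q + mean_boltzmann_entropy X A m q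
        \<le> shannon_entropy A (macro_evolution X A m \<alpha> q)
          + mean_boltzmann_entropy X A m (macro_evolution X A m \<alpha> q)"
      using shannon_entropy_le_evolution[OF uniform_lift_Prob[OF q]]
      by (simp add: coarse_grain_pushforward_uniform_lift shannon_entropy_uniform_lift
          q macro_evolution_Prob)
  qed
qed

end
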